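(* Let $S=\{1,\dots,n\}$ carry a metric $\mathrm{dist}$. Let $p_0\in\mathbb{R}^n$ be a probability vector (initial distribution), $Q\in\mathbb{R}^{n\times n}$ a generator matrix, and $p_t^{\mathsf T}=p_0^{\mathsf T}e^{tQ}$ for $t\ge 0$. Let $\pi_0\in\mathbb{R}^m$ be a probability vector, $\Theta\in\mathbb{R}^{m\times m}$ a generator matrix, and $A\in\mathbb{R}^{m\times n}$ a matrix with non-negative entries whose rows each sum to $1$. Put $\pi_t^{\mathsf T}=\pi_0^{\mathsf T}e^{t\Theta}$ and $\widetilde p_t^{\mathsf T}=\pi_0^{\mathsf T}e^{t\Theta}A$. Then $t\mapsto \mathrm{W}_1(\widetilde p_t,p_t)$ is continuous, its right derivative $\frac{\mathrm d}{\mathrm dt^+}\mathrm{W}_1(\widetilde p_t,p_t)$ exists for all $t\ge 0$, and for all $t\ge 0$ $$\frac{\mathrm d}{\mathrm dt^+}\mathrm{W}_1(\widetilde p_t,p_t)\le \pi_t^{\mathsf T}\,|\Theta A-AQ|_{\mathrm W}+K(Q)$$ and $$\frac{\mathrm d}{\mathrm dt^+}\mathrm{W}_1(\widetilde p_t,p_t)\le \pi_t^{\mathsf T}\,|\Theta A-AQ|_{\mathrm W}+\mathrm{W}_1(\widetilde p_t,p_t)\cdot(-\underline{k}(Q)).$$ Moreover, the second bound also holds with $\underline{k}(Q)$ replaced by $\underline{\kappa}(Q)$.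
   Context: Vectors are column vectors; $M_i$ denotes the $i$-th row of a matrix $M$. A generator matrix is a real square matrix with non-negative off-diagonal entries and all rows summing to $0$. Assume $n\ge 2$. Let $d_{\max}=\max_{r,s\in S}\mathrm{dist}(r,s)$ and $$\mathcal F=\{f\in\mathbb{R}^n:\ |f(r)-f(s)|\le \mathrm{dist}(r,s)\ \forall r,s\in S,\ 0\le f(s)\le d_{\max}\ \forall s\in S\}.$$ Wasserstein distance: for probability vectors $p,q\in\mathbb{R}^n$, $\mathrm{W}_1(p,q)=\min_{\gamma\in\Gamma(p,q)}\sum_{r,s\in S}\mathrm{dist}(r,s)\gamma(r,s)$, where $\Gamma(p,q)$ is the set of couplings of $p$ and $q$ (probability measures on $S\times S$ with first marginal $p$ and second marginal $q$); equivalently $\mathrm{W}_1(p,q)=\max_{f\in\mathcal F}(p^{\mathsf T}-q^{\mathsf T})f$. For $D\in\mathbb{R}^{m\times n}$ with rows summing to $0$, $|D|_{\mathrm W}\in\mathbb{R}^m$ is the column vector with $i$-th entry $\max_{f\in\mathcal F}D_i f$. (The rows of $\Theta A-AQ$ sum to $0$.) Coarse Ricci curvature: for $r\ne s$ in $S$, $\kappa(r,s)=-\frac{1}{\mathrm{dist}(r,s)}\frac{\mathrm d}{\mathrm dt}\big|_{t=0^+}\mathrm{W}_1(\delta_r^{\mathsf T}e^{tQ},\delta_s^{\mathsf T}e^{tQ})$, where $\delta_r$ is the Dirac vector at $r$ (this right derivative exists), and $\underline\kappa(Q)=\min_{r\ne s}\kappa(r,s)$. With $\mathrm{dist}(r,\cdot)=(\mathrm{dist}(r,1),\dots,\mathrm{dist}(r,n))^{\mathsf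 T}$, for $r\neq s$ let $$k(r,s)=-\frac{\min\{Q_r\,\mathrm{dist}(r,\cdot),\,Q_r\,\mathrm{dist}(s,\cdot)\}+\min\{Q_s\,\mathrm{dist}(s,\cdot),\,Q_s\,\mathrm{dist}(r,\cdot)\}}{\mathrm{dist}(r,s)},$$ $\underline{k}(Q)=\min_{r\ne s}k(r,s)$, and $K(Q)=\max\{0,\,-\min_{r\ne s}\mathrm{dist}(r,s)\,k(r,s)\}$. *)

theory Defs
  imports "HOL-Analysis.Analysis"
begin

(* The state space S = {1,...,n} is the finite index type 'n, so n = CARD('n). The metric is an
   explicit function on it, with Metric_space UNIV d as hypothesis. *)

definition prob_vector :: "real ^ 'n \<Rightarrow> bool" where
  "prob_vector p \<longleftrightarrow> (\<forall>i. 0 \<le> p $ i) \<and> (\<Sum>i\<in>UNIV. p $ i) = 1"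

definition generator_matrix :: "real ^ 'n ^ 'n \<Rightarrow> bool" where
  "generator_matrix Q \<longleftrightarrow>
     (\<forall>i j. i \<noteq> j \<longrightarrow> 0 \<le> Q $ i $ j) \<and> (\<forall>i. (\<Sum>j\<in>UNIV. Q $ i $ j) = 0)"

definition stochastic_matrix :: "real ^ 'n ^ 'm \<Rightarrow> bool" where
  "stochastic_matrix A \<longleftrightarrow> (\<forall>i. prob_vector (A $ i))"

(* The type class multiplication on vectors and matrices is componentwise, so the library's
   power and exp cannot be used here; the powers below are taken with respect to **. *)
primrec mat_power :: "real ^ 'n ^ 'n \<Rightarrow> nat \<Rightarrow> real ^ 'n ^ 'n" where
  "mat_power M 0 = mat 1"
| "mat_power M (Suc k) = M ** mat_power M k"

definition mat_exp :: "real ^ 'n ^ 'n \<Rightarrow> real ^ 'n ^ 'n" where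
  "mat_exp M = (\<Sum>k. mat_power M k /\<^sub>R fact k)"

definition diam :: "('n::finite \<Rightarrow> 'n \<Rightarrow> real) \<Rightarrow> real" where
  "diam d = Max {d r s | r s. True}"

definition lip_functions :: "('n \<Rightarrow> 'n \<Rightarrow> real) \<Rightarrow> (real ^ 'n) set" where
  "lip_functions d =
     {f. (\<forall>r s. \<bar>f $ r - f $ s\<bar> \<le> d r s) \<and> (\<forall>s. 0 \<le> f $ s \<and> f $ s \<le> diam d)}"

definition couplings :: "real ^ 'n \<Rightarrow> real ^ 'n \<Rightarrow> (real ^ 'n ^ 'n) set" where
  "couplings p q =
     {\<gamma>. (\<forall>r s. 0 \<le> \<gamma> $ r $ s) \<and>
         (\<forall>r. (\<Sum>s\<in>UNIV. \<gamma> $ r $ s) = p $ r) \<and>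
         (\<forall>s. (\<Sum>r\<in>UNIV. \<gamma> $ r $ s) = q $ s)}"

(* For probability vectors p and q the set of couplings is nonempty and compact, so the
   infimum is a minimum. *)
definition W1 :: "('n \<Rightarrow> 'n \<Rightarrow> real) \<Rightarrow> real ^ 'n \<Rightarrow> real ^ 'n \<Rightarrow> real" where
  "W1 d p q = (INF \<gamma>\<in>couplings p q. \<Sum>r\<in>UNIV. \<Sum>s\<in>UNIV. d r s * \<gamma> $ r $ s)"

(* D $ i is the i-th row of D. For a metric d the set lip_functions d is nonempty and compact,
   so the supremum is a maximum. *)
definition wnorm :: "('n \<Rightarrow> 'n \<Rightarrow> real) \<Rightarrow> real ^ 'n ^ 'm \<Rightarrow> real ^ 'm" where
  "wnorm d D = (\<chi> i. SUP f\<in>lip_functions d. D $ i \<bullet> f)"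

definition right_deriv :: "(real \<Rightarrow> real) \<Rightarrow> real \<Rightarrow> real" where
  "right_deriv f t = (THE D. (f has_real_derivative D) (at_right t))"

(* axis r 1 is the Dirac vector at r. *)
definition kappa :: "('n \<Rightarrow> 'n \<Rightarrow> real) \<Rightarrow> real ^ 'n ^ 'n \<Rightarrow> 'n \<Rightarrow> 'n \<Rightarrow> real" where
  "kappa d Q r s =
     - (1 / d r s) *
       right_deriv (\<lambda>t. W1 d (axis r 1 v* mat_exp (t *\<^sub>R Q)) (axis s 1 v* mat_exp (t *\<^sub>R Q))) 0"

definition kappa_min :: "('n \<Rightarrow> 'n \<Rightarrow> real) \<Rightarrow> real ^ 'n ^ 'n \<Rightarrow> real" where
  "kappa_min d Q = Min {kappa d Q r s | r s. r \<noteq> s}"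

definition dist_vec :: "('n \<Rightarrow> 'n \<Rightarrow> real) \<Rightarrow> 'n \<Rightarrow> real ^ 'n" where
  "dist_vec d r = (\<chi> j. d r j)"

definition kcurv :: "('n \<Rightarrow> 'n \<Rightarrow> real) \<Rightarrow> real ^ 'n ^ 'n \<Rightarrow> 'n \<Rightarrow> 'n \<Rightarrow> real" where
  "kcurv d Q r s =
     - (min (Q $ r \<bullet> dist_vec d r) (Q $ r \<bullet> dist_vec d s) +
        min (Q $ s \<bullet> dist_vec d s) (Q $ s \<bullet> dist_vec d r)) / d r s"

definition kcurv_min :: "('n \<Rightarrow> 'n \<Rightarrow> real) \<Rightarrow> real ^ 'n ^ 'n \<Rightarrow> real" where
  "kcurv_min d Q = Min {kcurv d Q r s | r s. r \<noteq> s}"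

definition Kconst :: "('n \<Rightarrow> 'n \<Rightarrow> real) \<Rightarrow> real ^ 'n ^ 'n \<Rightarrow> real" where
  "Kconst d Q = max 0 (- Min {d r s * kcurv d Q r s | r s. r \<noteq> s})"

end

theory Submission
  imports Defs
begin

text \<open>By Kantorovich duality, \<open>W1 d p q\<close> is the support function of the compact set of
  normalised \<open>1\<close>-Lipschitz functions, evaluated at \<open>p - q\<close>. Along a differentiable curve \<open>v\<close> such
  a support function has the right derivative \<open>v' \<bullet> f\<close> for a suitable maximiser \<open>f\<close> (Danskin).
  Here \<open>v' \<bullet> f\<close> splits into a term bounded by \<open>\<pi> t \<bullet> wnorm d (\<Theta> ** A - A ** Q)\<close> and the term
  \<open>(p_tilde t - p t) \<bullet> (Q *v f)\<close>. Writing the latter with an optimal coupling, only pairs \<open>r, s\<close>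
  with \<open>f $ r - f $ s = d r s\<close> contribute; for these, \<open>f\<close> is also optimal between the Dirac
  vectors at \<open>r\<close> and \<open>s\<close>, so that \<open>(Q $ r - Q $ s) \<bullet> f\<close> is at most \<open>- d r s * kappa d Q r s\<close>,
  and the triangle inequality bounds it by \<open>- d r s * kcurv d Q r s\<close>.\<close>

subsection \<open>The matrix exponential\<close>

lemma mat_power_commute: "mat_power M k ** M = M ** mat_power M k"
  by (induction k) (simp_all add: matrix_mul_assoc[symmetric])

lemma mat_power_scaleR: "mat_power (t *\<^sub>R M) k = t ^ k *\<^sub>R mat_power M k"
  by (induction k) (simp_all add: matrix_scalar_ac scalar_matrix_assoc[symmetric])

lemma mat_power_nonneg:
  fixes M :: "real ^ 'n ^ 'n"
  assumes "\<And>i j. 0 \<le> M $ i $ j"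
  shows "0 \<le> mat_power M k $ i $ j"
proof (induction k arbitrary: i j)
  case 0
  then show ?case by (simp add: mat_def)
next
  case (Suc k)
  then show ?case
    by (auto simp: matrix_matrix_mult_def assms intro!: sum_nonneg)
qed

text \<open>The sum of all absolute entries dominates each absolute row sum, the factor picked up by
  one multiplication with \<open>M\<close>. This geometric bound lets an exponential series majorise
  the entries of \<open>mat_exp\<close>.\<close>

lemma mat_power_entry_bound:
  fixes M :: "real ^ 'n ^ 'n"
  shows "\<bar>mat_power M k $ i $ j\<bar> \<le> (\<Sum>i\<in>UNIV. \<Sum>j\<in>UNIV. \<bar>M $ i $ j\<bar>) ^ k"
proof (induction k arbitrary: i j)
  case 0
  then show ?case by (simp add: mat_def)
next
  case (Suc k)
  let ?C = "\<Sum>i\<in>UNIV. \<Sum>j\<in>UNIV. \<bar>M $ i $ j\<bar>"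
  have "\<bar>mat_power M (Suc k) $ i $ j\<bar> \<le> (\<Sum>l\<in>UNIV. \<bar>M $ i $ l * mat_power M k $ l $ j\<bar>)"
    by (simp add: matrix_matrix_mult_def sum_abs)
  also have "\<dots> \<le> (\<Sum>l\<in>UNIV. \<bar>M $ i $ l\<bar> * ?C ^ k)"
    by (intro sum_mono) (simp add: abs_mult Suc mult_left_mono)
  also have "\<dots> = (\<Sum>l\<in>UNIV. \<bar>M $ i $ l\<bar>) * ?C ^ k"
    by (simp add: sum_distrib_right)
  also have "\<dots> \<le> ?C * ?C ^ k"
    by (intro mult_right_mono member_le_sum[of i UNIV "\<lambda>i. \<Sum>l\<in>UNIV. \<bar>M $ i $ l\<bar>"])
      (auto intro!: sum_nonneg zero_le_power)
  finally show ?case by simp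
qed

text \<open>Each entry is put in the form of a real power series in \<open>t\<close> converging
  everywhere, so that it can be differentiated termwise.\<close>

lemma summable_mat_power_entry:
  fixes M :: "real ^ 'n ^ 'n"
  shows "summable (\<lambda>k. mat_power M k $ i $ j / fact k * t ^ k)"
proof (rule summable_comparison_test')
  let ?C = "\<Sum>i\<in>UNIV. \<Sum>j\<in>UNIV. \<bar>M $ i $ j\<bar>"
  show "summable (\<lambda>k. inverse (fact k) * (?C * \<bar>t\<bar>) ^ k)"
    by (rule summable_exp)
  show "norm (mat_power M k $ i $ j / fact k * t ^ k) \<le> inverse (fact k) * (?C * \<bar>t\<bar>) ^ k" for k
    using mult_right_mono[OF mat_power_entry_bound[of M k i j], of "\<bar>t\<bar> ^ k / fact k"]
    by (simp add: abs_mult power_abs power_mult_distrib field_simps)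
qed

text \<open>Convergence of every entry gives convergence of the matrix series, so the
  \<open>suminf\<close> in \<open>mat_exp\<close> is a genuine limit.\<close>

lemma sums_mat_exp: "(\<lambda>k. mat_power M k /\<^sub>R fact k) sums mat_exp M"
proof -
  have "(\<lambda>k. mat_power M k /\<^sub>R fact k) sums (\<chi> i j. \<Sum>k. mat_power M k $ i $ j / fact k)"
    unfolding sums_def
    using summable_LIMSEQ[OF summable_mat_power_entry[of M _ _ 1]]
    by (intro vec_tendstoI) (simp add: sum_component divide_inverse_commute)
  then show ?thesis
    unfolding mat_exp_def by (meson summable_sums sums_summable)
qed

lemma mat_exp_entry:
  "mat_exp (t *\<^sub>R M) $ i $ j = (\<Sum>k. mat_power M k $ i $ j / fact k * t ^ k)"
proof -
  have "(\<lambda>k. (mat_power (t *\<^sub>R M) k /\<^sub>R fact k) $ i $ j) sums (mat_exp (t *\<^sub>R M) $ i $ j)"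
    by (intro bounded_linear.sums[OF bounded_linear_vec_nth] sums_mat_exp)
  then show ?thesis
    by (simp add: mat_power_scaleR sums_unique field_simps)
qed

lemma mat_exp_0: "mat_exp (0 *\<^sub>R M) = mat 1"
proof -
  have "mat_exp (0 *\<^sub>R M) $ i $ j = mat 1 $ i $ j" for i j
    unfolding mat_exp_entry using powser_zero[of "\<lambda>k. mat_power M k $ i $ j / fact k"] by simp
  then show ?thesis
    by (simp add: vec_eq_iff)
qed

text \<open>Multiplication by \<open>M\<close> from either side is linear, hence bounded in finite
  dimension, and so passes through the series, whose terms commute with \<open>M\<close>.\<close>

lemma mat_exp_commute: "mat_exp M ** M = M ** mat_exp M"
proof -
  have "linear (\<lambda>X. X ** M)" "linear (\<lambda>X. M ** X)"
    by (auto intro!: linearI simp: vec_eq_iff matrix_matrix_mult_def sum.distrib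
        distrib_left distrib_right sum_distrib_left mult.assoc mult.left_commute)
  then have "bounded_linear (\<lambda>X. X ** M)" "bounded_linear (\<lambda>X. M ** X)"
    by (auto simp: linear_conv_bounded_linear)
  from this[THEN bounded_linear.sums, OF sums_mat_exp[of M]] show ?thesis
    by (simp add: mat_power_commute scalar_matrix_assoc[symmetric] matrix_scalar_ac sums_unique2)
qed

lemma mat_exp_commute_scaleR: "mat_exp (t *\<^sub>R M) ** M = M ** mat_exp (t *\<^sub>R M)"
  using mat_exp_commute[of "t *\<^sub>R M"]
  \<comment> \<open>For nonzero \<open>t\<close> the scalar cancels; for \<open>t = 0\<close> both
    sides equal \<open>M\<close>.\<close>
  by (cases "t = 0") (simp_all add: mat_exp_0[simplified] matrix_scalar_ac scalar_matrix_assoc[symmetric])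

lemma has_real_derivative_mat_exp_entry:
  "((\<lambda>t. mat_exp (t *\<^sub>R M) $ i $ j) has_real_derivative (mat_exp (t *\<^sub>R M) ** M) $ i $ j) (at t)"
proof -
  let ?c = "\<lambda>i j k. mat_power M k $ i $ j / fact k"
  \<comment> \<open>Differentiation turns \<open>fact (Suc k)\<close> into \<open>fact k\<close>,
    and one factor \<open>M\<close> is split off on the right, where it acts on row vectors.\<close>
  have diffs: "diffs (?c i j) k * t ^ k = (\<Sum>l\<in>UNIV. ?c i l k * t ^ k * M $ l $ j)" for k
  proof -
    have "diffs (?c i j) k = mat_power M (Suc k) $ i $ j / fact k"
      by (simp add: diffs_def del: mat_power.simps)
    also have "mat_power M (Suc k) $ i $ j = (\<Sum>l\<in>UNIV. mat_power M k $ i $ l * M $ l $ j)"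
      by (simp add: mat_power_commute[symmetric]) (simp add: matrix_matrix_mult_def)
    finally show ?thesis
      by (simp only: sum_divide_distrib sum_distrib_right)
        (intro sum.cong refl, simp add: mult.commute mult.left_commute)
  qed
  have "(\<Sum>k. diffs (?c i j) k * t ^ k) = (\<Sum>l\<in>UNIV. (\<Sum>k. ?c i l k * t ^ k * M $ l $ j))"
    unfolding diffs by (intro suminf_sum summable_mult2 summable_mat_power_entry)
  also have "\<dots> = (mat_exp (t *\<^sub>R M) ** M) $ i $ j"
    by (simp only: matrix_matrix_mult_def vec_lambda_beta mat_exp_entry
        suminf_mult2[OF summable_mat_power_entry])
  finally show ?thesis
    using termdiffs_strong_converges_everywhere[of "?c i j" t, OF summable_mat_power_entry]
    by (simp add: mat_exp_entry)
qed

section \<open>Row vectors moved by the exponential, as solutions of a linear differential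
  equation\<close>

lemma has_real_derivative_mat_exp_row:
  "((\<lambda>t. (x v* mat_exp (t *\<^sub>R M)) $ j) has_real_derivative
     (x v* mat_exp (t *\<^sub>R M) v* M) $ j) (at t)"
  unfolding vector_matrix_mul_assoc unfolding vector_matrix_mult_def vec_lambda_beta
  by (intro DERIV_sum DERIV_cmult has_real_derivative_mat_exp_entry)

text \<open>The product rule gives the left side the derivative \<open>x M E - x E M\<close>, which
  vanishes because \<open>M\<close> commutes with its exponential \<open>E\<close>.\<close>

lemma linear_ode_mat_exp_neg:
  fixes x :: "real \<Rightarrow> real ^ 'n" and M :: "real ^ 'n ^ 'n"
  assumes "\<And>t j. ((\<lambda>t. x t $ j) has_real_derivative (x t v* M) $ j) (at t)"
  shows "x t v* mat_exp (- t *\<^sub>R M) = x 0"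
proof -
  let ?E = "\<lambda>t. mat_exp (- t *\<^sub>R M)"
  have E: "((\<lambda>t. ?E t $ i $ j) has_real_derivative - (?E t ** M) $ i $ j) (at t)" for i j t
    using DERIV_chain'[OF DERIV_minus[OF DERIV_ident] has_real_derivative_mat_exp_entry] by simp
  have "((\<lambda>t. (x t v* ?E t) $ j) has_real_derivative 0) (at t)" for j t
  proof -
    have "((\<lambda>t. (x t v* ?E t) $ j) has_real_derivative
        (\<Sum>i\<in>UNIV. (x t v* M) $ i * ?E t $ i $ j + - (?E t ** M) $ i $ j * x t $ i)) (at t)"
      unfolding vector_matrix_mult_def[of _ "?E _"] vec_lambda_beta
      by (intro DERIV_sum DERIV_mult assms E)
    also have "(\<Sum>i\<in>UNIV. (x t v* M) $ i * ?E t $ i $ j + - (?E t ** M) $ i $ j * x t $ i)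
      = (x t v* M v* ?E t - x t v* (?E t ** M)) $ j"
      unfolding vector_matrix_mult_def[of "x t v* M"] vector_matrix_mult_def[of _ "?E t ** M"]
      by (simp add: sum.distrib sum_subtractf sum_negf mult.commute)
    also have "\<dots> = 0"
      using mat_exp_commute_scaleR[of "- t" M] by (simp add: vector_matrix_mul_assoc)
    finally show ?thesis .
  qed
  then have "(x t v* ?E t) $ j = (x 0 v* ?E 0) $ j" for j
    by (intro DERIV_isconst_all) auto
  then show ?thesis
    by (simp add: vec_eq_iff mat_exp_0[simplified])
qed

lemma linear_ode_unique:
  fixes x :: "real \<Rightarrow> real ^ 'n" and M :: "real ^ 'n ^ 'n"
  assumes "\<And>t j. ((\<lambda>t. x t $ j) has_real_derivative (x t v* M) $ j) (at t)"
  shows "x t = x 0 v* mat_exp (t *\<^sub>R M)"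
proof -
  \<comment> \<open>The previous lemma, applied to the solution
    \<open>y v* mat_exp (t *\<^sub>R M)\<close> at time \<open>- t\<close>, inverts the
    exponential.\<close>
  have "y v* mat_exp (- t *\<^sub>R M) v* mat_exp (t *\<^sub>R M) = y" for y
    using linear_ode_mat_exp_neg[of "\<lambda>t. y v* mat_exp (t *\<^sub>R M)" M "- t",
        OF has_real_derivative_mat_exp_row]
    by (simp add: mat_exp_0[simplified])
  then show ?thesis
    by (metis linear_ode_mat_exp_neg[OF assms])
qed

text \<open>Uniformisation: shifting \<open>Q\<close> by a large multiple \<open>c\<close> of the
  identity gives a matrix \<open>P\<close> with nonnegative entries, whose exponential series has
  nonnegative terms. Uniqueness for the linear equation shows that the shift only contributes the
  positive factor \<open>exp (c * t)\<close>.\<close>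

lemma mat_exp_row_nonneg:
  fixes Q :: "real ^ 'n ^ 'n"
  assumes "generator_matrix Q" and "\<And>i. 0 \<le> x $ i" and "0 \<le> t"
  shows "0 \<le> (x v* mat_exp (t *\<^sub>R Q)) $ j"
proof -
  define c where "c = (\<Sum>i\<in>UNIV. \<bar>Q $ i $ i\<bar>)"
  define P where "P = Q + mat c"
  define y where "y = (\<lambda>t. exp (c * t) *\<^sub>R (x v* mat_exp (t *\<^sub>R Q)))"
  have "\<bar>Q $ i $ i\<bar> \<le> c" for i
    unfolding c_def by (intro member_le_sum) auto
  then have "0 \<le> Q $ i $ i + c" for i
    by (smt (verit))
  then have "0 \<le> P $ i $ j" for i j
    using assms(1) by (cases "i = j") (simp_all add: P_def mat_def generator_matrix_def)
  then have "0 \<le> mat_exp (t *\<^sub>R P) $ i $ j" for i j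
    using assms(3) unfolding mat_exp_entry
    by (intro suminf_nonneg summable_mat_power_entry mult_nonneg_nonneg divide_nonneg_pos
        mat_power_nonneg) auto
  moreover have mc: "z v* mat c = c *\<^sub>R z" for z :: "real ^ 'n"
    by (simp add: vec_eq_iff vector_matrix_mult_def mat_def if_distrib cong: if_cong)
  have "((\<lambda>t. y t $ j) has_real_derivative (y t v* P) $ j) (at t)" for t j
  proof -
    have "((\<lambda>t. exp (c * t)) has_real_derivative c * exp (c * t)) (at t)"
      by (auto intro!: derivative_eq_intros)
    from DERIV_mult[OF this has_real_derivative_mat_exp_row[of x Q j t]] show ?thesis
      unfolding y_def P_def vector_scaleR_component real_scaleR_def
      by (rule DERIV_cong)
        (simp add: vector_matrix_mult_add_rdistrib mc scaleR_vector_matrix_assoc mult_ac)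
  qed
  then have "y t = x v* mat_exp (t *\<^sub>R P)"
    using linear_ode_unique[of y P t] by (simp add: y_def mat_exp_0[simplified])
  ultimately have "0 \<le> y t $ j"
    using assms(2) by (simp add: vector_matrix_mult_def sum_nonneg)
  then show ?thesis
    by (simp add: y_def zero_le_mult_iff)
qed

text \<open>Total mass is constant in time because the rows of \<open>Q\<close> sum to zero.\<close>

lemma prob_vector_mat_exp:
  assumes "prob_vector x" and "generator_matrix Q" and "0 \<le> t"
  shows "prob_vector (x v* mat_exp (t *\<^sub>R Q))"
proof -
  let ?y = "\<lambda>t. x v* mat_exp (t *\<^sub>R Q)"
  have "((\<lambda>t. \<Sum>j\<in>UNIV. ?y t $ j) has_real_derivative (\<Sum>j\<in>UNIV. (?y t v* Q) $ j)) (at t)" for t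
    by (intro DERIV_sum has_real_derivative_mat_exp_row)
  moreover have "(\<Sum>j\<in>UNIV. (z v* Q) $ j) = 0" for z
    using assms(2) sum.swap[of "\<lambda>j i. z $ i * Q $ i $ j" UNIV UNIV]
    by (simp add: vector_matrix_mult_def generator_matrix_def sum_distrib_left[symmetric])
  ultimately have "(\<Sum>j\<in>UNIV. ?y t $ j) = (\<Sum>j\<in>UNIV. ?y 0 $ j)"
    using DERIV_isconst_all by (metis (no_types, lifting))
  then show ?thesis
    using assms mat_exp_row_nonneg[OF assms(2) _ assms(3)]
    by (simp add: prob_vector_def mat_exp_0[simplified])
qed

lemma prob_vector_stochastic_matrix:
  assumes "prob_vector x" and "stochastic_matrix A"
  shows "prob_vector (x v* A)"
  using assms sum.swap[of "\<lambda>j i. x $ i * A $ i $ j" UNIV UNIV]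
  by (auto simp: prob_vector_def stochastic_matrix_def vector_matrix_mult_def
      sum_distrib_left[symmetric] intro!: sum_nonneg)

subsection \<open>Support functions of compact sets\<close>

text \<open>With \<open>F = lip_functions d\<close> this covers both \<open>W1\<close>, by duality
  at \<open>p - q\<close>, and the components of \<open>wnorm\<close>, at the rows of the
  matrix.\<close>

definition support_function :: "(real ^ 'n) set \<Rightarrow> real ^ 'n \<Rightarrow> real" where
  "support_function F v = (SUP f\<in>F. v \<bullet> f)"

lemma support_function_attained:
  assumes "compact F" and "F \<noteq> {}"
  obtains f where "f \<in> F" and "support_function F v = v \<bullet> f"
proof -
  obtain f where f: "f \<in> F" "\<And>g. g \<in> F \<Longrightarrow> v \<bullet> g \<le> v \<bullet> f"
    using continuous_attains_sup[OF assms continuous_on_inner[OF continuous_on_const continuous_on_id]]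
    by blast
  then have "support_function F v = v \<bullet> f"
    unfolding support_function_def by (intro cSup_eq_maximum) auto
  with f that show thesis by blast
qed

lemma support_function_upper:
  assumes "compact F" and "f \<in> F"
  shows "v \<bullet> f \<le> support_function F v"
proof -
  have "compact ((\<lambda>f. v \<bullet> f) ` F)"
    by (intro compact_continuous_image assms continuous_intros)
  then show ?thesis
    unfolding support_function_def
    by (intro cSUP_upper assms bounded_imp_bdd_above compact_imp_bounded)
qed

text \<open>A maximiser at \<open>v\<close> is a competitor at \<open>w\<close>, so a bound on the
  norms in \<open>F\<close> is a Lipschitz constant.\<close>

lemma continuous_support_function:
  assumes "compact F" and "F \<noteq> {}"
  shows "continuous_on UNIV (support_function F)"
proof -
  obtain B where B: "\<And>f. f \<in> F \<Longrightarrow> norm f \<le> B"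
    using compact_imp_bounded[OF assms(1)] by (auto simp: bounded_iff)
  have le: "support_function F v \<le> support_function F w + B * norm (v - w)" for v w
  proof -
    obtain f where f: "f \<in> F" "support_function F v = v \<bullet> f"
      using support_function_attained[OF assms] .
    have "v \<bullet> f = w \<bullet> f + (v - w) \<bullet> f"
      by (simp add: inner_diff_left)
    also have "\<dots> \<le> support_function F w + norm (v - w) * norm f"
      by (intro add_mono support_function_upper assms f norm_cauchy_schwarz)
    also have "\<dots> \<le> support_function F w + B * norm (v - w)"
      using mult_left_mono[OF B[OF f(1)], of "norm (v - w)"] by (simp add: mult.commute)
    finally show ?thesis using f by simp
  qed
  have "0 \<le> B"
    using assms(2) B norm_ge_zero order_trans by blast
  then have "B-lipschitz_on UNIV (support_function F)"
  proof (intro lipschitz_onI)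
    show "dist (support_function F v) (support_function F w) \<le> B * dist v w" for v w
      using le[of v w] le[of w v] by (simp add: dist_norm norm_minus_commute abs_le_iff)
  qed
  then show ?thesis
    by (rule lipschitz_on_continuous_on)
qed

text \<open>Among the maximisers at time \<open>t\<close>, \<open>f\<close> is one that is best in
  direction \<open>v'\<close>. Keeping \<open>f\<close> fixed bounds the difference quotients from
  below; for the upper bound, maximisers at later times accumulate at a maximiser at time
  \<open>t\<close>. The extremality of \<open>f\<close> is exported because it identifies the
  derivative occurring in \<open>kappa\<close>.\<close>

lemma has_right_derivative_support_function:
  assumes F: "compact F" "F \<noteq> {}"
    and v: "\<And>j. ((\<lambda>s. v s $ j) has_real_derivative v' $ j) (at_right t)"
  obtains f where "f \<in> F" and "v t \<bullet> f = support_function F (v t)"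
    and "\<forall>g\<in>F. v t \<bullet> g = support_function F (v t) \<longrightarrow> v' \<bullet> g \<le> v' \<bullet> f"
    and "((\<lambda>s. support_function F (v s)) has_real_derivative v' \<bullet> f) (at_right t)"
proof -
  define F' where "F' = {f \<in> F. v t \<bullet> f = support_function F (v t)}"
  define quot where "quot = (\<lambda>s. (v s - v t) /\<^sub>R (s - t))"
  have "closed {f. v t \<bullet> f = support_function F (v t)}"
    by (intro closed_Collect_eq continuous_intros)
  then have "compact F'"
    unfolding F'_def using compact_Int_closed[OF F(1)] by (simp add: Collect_conj_eq)
  moreover have "F' \<noteq> {}"
    using support_function_attained[OF F, of "v t"] unfolding F'_def
    by (metis (mono_tags, lifting) empty_iff mem_Collect_eq)
  ultimately obtain f where "f \<in> F'" "support_function F' v' = v' \<bullet> f"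
    using support_function_attained by blast
  then have f: "f \<in> F'" "\<And>g. g \<in> F' \<Longrightarrow> v' \<bullet> g \<le> v' \<bullet> f"
    using support_function_upper[OF \<open>compact F'\<close>] by metis+
  have quot: "(quot \<longlongrightarrow> v') (at_right t)"
    using v unfolding quot_def has_field_derivative_iff
    by (intro vec_tendstoI) (simp add: divide_inverse_commute)
  define h where "h = (\<lambda>s. (support_function F (v s) - support_function F (v t)) / (s - t))"
  \<comment> \<open>\<open>f\<close> is optimal at time \<open>t\<close> and still admissible at
    time \<open>s\<close>.\<close>
  have h_ge: "quot s \<bullet> f \<le> h s" if "t < s" for s
  proof -
    have "v s \<bullet> f - v t \<bullet> f \<le> support_function F (v s) - support_function F (v t)"
      using f(1) support_function_upper[OF F(1), of f "v s"] by (simp add: F'_def)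
    then show ?thesis
      using that by (simp add: quot_def h_def inner_diff_left divide_right_mono divide_inverse_commute)
  qed
  have "(h \<longlongrightarrow> v' \<bullet> f) (at_right t)"
  proof (rule order_tendstoI)
    fix a assume "a < v' \<bullet> f"
    have "((\<lambda>s. quot s \<bullet> f) \<longlongrightarrow> v' \<bullet> f) (at_right t)"
      by (intro tendsto_intros quot)
    from order_tendstoD(1)[OF this \<open>a < v' \<bullet> f\<close>]
    have "\<forall>\<^sub>F s in at_right t. a < quot s \<bullet> f" .
    moreover have "\<forall>\<^sub>F s in at_right t. t < s"
      by (rule eventually_at_right_less)
    ultimately show "\<forall>\<^sub>F s in at_right t. a < h s"
      by eventually_elim (use h_ge in force)
  next
    fix a assume a: "v' \<bullet> f < a"
    show "\<forall>\<^sub>F s in at_right t. h s < a"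
    proof (rule ccontr)
      assume "\<not> (\<forall>\<^sub>F s in at_right t. h s < a)"
      then have "\<exists>s>t. s < t + inverse (Suc k) \<and> a \<le> h s" for k
        unfolding eventually_at_right_field
        by (metis less_add_same_cancel1 linorder_not_less of_nat_0_less_iff positive_imp_inverse_positive zero_less_Suc)
      then obtain s where s: "\<And>k. t < s k" "\<And>k. s k < t + inverse (Suc k)" "\<And>k. a \<le> h (s k)"
        by metis
      \<comment> \<open>Maximisers at the times \<open>s k\<close>, which decrease to
        \<open>t\<close> only in the sense of the bound by \<open>inverse (Suc k)\<close>, have a
        subsequence with limit \<open>l\<close>. This \<open>l\<close> will be a maximiser at
        \<open>t\<close> that beats \<open>f\<close> in direction \<open>v'\<close>.\<close>
      have "\<exists>m. m \<in> F \<and> support_function F (v (s k)) = v (s k) \<bullet> m" for k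
        using support_function_attained[OF F] by blast
      then obtain m where m: "\<And>k. m k \<in> F" "\<And>k. support_function F (v (s k)) = v (s k) \<bullet> m k"
        by metis
      obtain l r where l: "l \<in> F" and r: "strict_mono r" "(m \<circ> r) \<longlonglongrightarrow> l"
        using F(1) m(1) unfolding compact_def by blast
      have "s \<longlonglongrightarrow> t"
      proof (rule tendsto_sandwich[of "\<lambda>_. t" s sequentially "\<lambda>k. t + inverse (Suc k)"])
        show "(\<lambda>k. t + inverse (Suc k)) \<longlonglongrightarrow> t"
          using tendsto_add[OF tendsto_const LIMSEQ_inverse_real_of_nat] by fastforce
      qed (use s in \<open>auto intro!: always_eventually less_imp_le\<close>)
      then have "filterlim s (at_right t) sequentially"
        using s(1) by (simp add: filterlim_at less_imp_neq[THEN not_sym])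
      from filterlim_compose[OF this filterlim_subseq[OF r(1)]]
      have sr: "filterlim (\<lambda>k. s (r k)) (at_right t) sequentially" .
      have vs: "(v \<longlongrightarrow> v t) (at_right t)"
        using DERIV_continuous[OF v] by (intro vec_tendstoI) (simp add: continuous_within)
      have vsr: "(\<lambda>k. v (s (r k))) \<longlonglongrightarrow> v t"
        by (rule filterlim_compose[OF vs sr])
      have "(\<lambda>k. v (s (r k)) \<bullet> (m \<circ> r) k) \<longlonglongrightarrow> v t \<bullet> l"
        by (rule tendsto_inner[OF vsr r(2)])
      moreover have "(\<lambda>k. support_function F (v (s (r k)))) \<longlonglongrightarrow> support_function F (v t)"
        by (rule continuous_on_tendsto_compose[OF continuous_support_function[OF F] vsr]) auto
      ultimately have "v t \<bullet> l = support_function F (v t)"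
        using LIMSEQ_unique by (simp add: m(2))
      with l f(2) have "v' \<bullet> l \<le> v' \<bullet> f"
        by (simp add: F'_def)
      moreover have "a \<le> v' \<bullet> l"
      proof (rule tendsto_lowerbound)
        show "(\<lambda>k. quot (s (r k)) \<bullet> (m \<circ> r) k) \<longlonglongrightarrow> v' \<bullet> l"
          by (rule tendsto_inner[OF filterlim_compose[OF quot sr] r(2)])
        \<comment> \<open>The roles are now reversed: \<open>m k\<close> is optimal at time
          \<open>s k\<close> and merely admissible at \<open>t\<close>.\<close>
        have "h (s k) \<le> quot (s k) \<bullet> m k" for k
        proof -
          have "support_function F (v (s k)) - support_function F (v t) \<le> v (s k) \<bullet> m k - v t \<bullet> m k"
            using m support_function_upper[OF F(1), of "m k" "v t"] by simp
          then show ?thesis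
            using s(1)[of k]
            by (simp add: quot_def h_def inner_diff_left divide_right_mono divide_inverse_commute)
        qed
        then show "\<forall>\<^sub>F k in sequentially. a \<le> quot (s (r k)) \<bullet> (m \<circ> r) k"
          using s(3) by (auto intro: order_trans always_eventually)
      qed simp
      ultimately show False using a by simp
    qed
  qed
  then have "((\<lambda>s. support_function F (v s)) has_real_derivative v' \<bullet> f) (at_right t)"
    by (simp add: has_field_derivative_iff h_def)
  with f show thesis
    by (intro that) (auto simp: F'_def)
qed

subsection \<open>Kantorovich duality\<close>

lemma le_diam:
  fixes d :: "'n::finite \<Rightarrow> 'n \<Rightarrow> real"
  shows "d r s \<le> diam d"
proof -
  have "finite {d r s | r s. True}"
    using finite_imageI[of "UNIV :: ('n \<times> 'n) set" "\<lambda>(r, s). d r s"]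
    by (rule rev_finite_subset) auto
  then show ?thesis
    unfolding diam_def by (intro Max_ge) auto
qed

text \<open>The normalisation between \<open>0\<close> and \<open>diam d\<close> encloses the set in
  a box; the Lipschitz conditions alone would allow arbitrary constants to be added.\<close>

lemma compact_lip_functions: "compact (lip_functions (d :: 'n::finite \<Rightarrow> 'n \<Rightarrow> real))"
proof -
  have "lip_functions d \<subseteq> cbox 0 (\<chi> i. diam d)"
    by (auto simp: lip_functions_def mem_box_cart)
  moreover have "closed (lip_functions d)"
    unfolding lip_functions_def
    by (intro closed_Collect_conj closed_Collect_all closed_Collect_le continuous_intros)
  ultimately show ?thesis
    using bounded_subset[OF bounded_cbox] compact_eq_bounded_closed by blast
qed

lemma lip_functions_nonempty:
  fixes d :: "'n::finite \<Rightarrow> 'n \<Rightarrow> real"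
  assumes "Metric_space UNIV d"
  shows "lip_functions d \<noteq> {}"
proof -
  have "0 \<le> diam d"
    using le_diam[of d] Metric_space.nonneg[OF assms] order_trans by blast
  then have "0 \<in> lip_functions d"
    using Metric_space.nonneg[OF assms] by (simp add: lip_functions_def)
  then show ?thesis by blast
qed

text \<open>Both marginals are expanded through the coupling. As \<open>f\<close> is arbitrary, this
  serves for a potential as well as for \<open>Q *v f\<close>.\<close>

lemma coupling_diff_inner:
  fixes p q :: "real ^ 'n"
  assumes "\<gamma> \<in> couplings p q"
  shows "(p - q) \<bullet> f = (\<Sum>r\<in>UNIV. \<Sum>s\<in>UNIV. \<gamma> $ r $ s * (f $ r - f $ s))"
proof -
  have "(\<Sum>r\<in>UNIV. \<Sum>s\<in>UNIV. \<gamma> $ r $ s * f $ r) = p \<bullet> f"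
    using assms by (simp add: couplings_def inner_vec_def sum_distrib_right[symmetric])
  moreover have "(\<Sum>r\<in>UNIV. \<Sum>s\<in>UNIV. \<gamma> $ r $ s * f $ s) = q \<bullet> f"
    using assms by (subst sum.swap)
      (simp add: couplings_def inner_vec_def sum_distrib_right[symmetric])
  ultimately show ?thesis
    by (simp add: inner_diff_left right_diff_distrib sum_subtractf)
qed

text \<open>The competitor is the \<open>c\<close>-transform of the separating functional, shifted to have
  minimum \<open>0\<close>; the shift is harmless because \<open>p - q\<close> has total mass \<open>0\<close>.\<close>

lemma dual_potential:
  fixes p q u v :: "real ^ 'n"
  assumes d: "Metric_space UNIV d" and p: "prob_vector p" and q: "prob_vector q"
    and less: "u \<bullet> p + v \<bullet> q + c < b"
    and le: "\<And>r s. b \<le> u $ r + v $ s + d r s"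
  shows "\<exists>f\<in>lip_functions d. c < (p - q) \<bullet> f"
proof -
  define g where "g r = Min (range (\<lambda>s. d r s + v $ s))" for r
  have g_le: "g r \<le> d r s + v $ s" for r s
    unfolding g_def by (intro Min_le) auto
  have g_ex: "\<exists>s. g r = d r s + v $ s" for r
    using Min_in[of "range (\<lambda>s. d r s + v $ s)"] by (auto simp: g_def image_iff)
  have lip: "g r - g s \<le> d r s" for r s
    using g_ex[of s] g_le[of r] Metric_space.triangle[OF d, of r s] by (smt (verit) UNIV_I)
  obtain r0 where r0: "\<And>r. g r0 \<le> g r"
    using Min_in[of "range g"] Min_le[of "range g"] by fastforce
  define f :: "real ^ 'n" where "f = (\<chi> r. g r - g r0)"
  have "f \<in> lip_functions d"
    unfolding lip_functions_def
  proof (intro CollectI conjI allI)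
    show "\<bar>f $ r - f $ s\<bar> \<le> d r s" for r s
      using lip[of r s] lip[of s r] Metric_space.commute[OF d, of r s] by (simp add: f_def abs_le_iff)
    show "f $ s \<le> diam d" for s
      using lip[of s r0] le_diam[of d s r0] by (simp add: f_def)
  qed (simp add: f_def r0)
  moreover have "c < (p - q) \<bullet> f"
  proof -
    have "(p - q) \<bullet> f = (\<Sum>r\<in>UNIV. p $ r * g r) - (\<Sum>r\<in>UNIV. q $ r * g r)"
      using p q
      by (simp add: prob_vector_def f_def inner_vec_def algebra_simps sum.distrib sum_subtractf
          sum_distrib_left[symmetric])
    \<comment> \<open>The separation inequality bounds \<open>g\<close> below by
      \<open>b - u\<close>; choosing \<open>s = r\<close> in the minimum, where the distance
      vanishes, bounds it above by \<open>v\<close>.\<close>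
    also have "\<dots> \<ge> (\<Sum>r\<in>UNIV. p $ r * (b - u $ r)) - (\<Sum>r\<in>UNIV. q $ r * v $ r)"
    proof (intro diff_mono sum_mono mult_left_mono)
      show "b - u $ r \<le> g r" for r
        using g_ex[of r] le[of r] by (smt (verit))
      show "g r \<le> v $ r" for r
        using g_le[of r r] Metric_space.mdist_zero[OF d] by simp
    qed (use p q in \<open>auto simp: prob_vector_def\<close>)
    also have "(\<Sum>r\<in>UNIV. p $ r * (b - u $ r)) = b - u \<bullet> p"
      using p by (simp add: prob_vector_def inner_vec_def right_diff_distrib sum_subtractf
          sum_distrib_right[symmetric] mult.commute[of "u $ _"])
    also have "(\<Sum>r\<in>UNIV. q $ r * v $ r) = v \<bullet> q"
      by (simp add: inner_vec_def mult.commute)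
    finally show ?thesis using less by simp
  qed
  ultimately show ?thesis by blast
qed

text \<open>The hard half of duality, by separation. Marginals and cost of all couplings of
  probability vectors fill the convex hull \<open>T\<close> of the triples of single pairs. If
  \<open>T\<close> missed the half-line \<open>L\<close> of triples with marginals \<open>p\<close>,
  \<open>q\<close> and cost at most \<open>c\<close>, a separating hyperplane would yield a
  potential with value above \<open>c\<close>.\<close>

lemma exists_coupling_cost_le:
  fixes p q :: "real ^ 'n"
  assumes d: "Metric_space UNIV d" and p: "prob_vector p" and q: "prob_vector q"
    and c: "\<And>f. f \<in> lip_functions d \<Longrightarrow> (p - q) \<bullet> f \<le> c"
  shows "\<exists>\<gamma>\<in>couplings p q. (\<Sum>r\<in>UNIV. \<Sum>s\<in>UNIV. d r s * \<gamma> $ r $ s) \<le> c"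
proof -
  define e :: "'n \<times> 'n \<Rightarrow> (real ^ 'n) \<times> (real ^ 'n) \<times> real"
    where "e = (\<lambda>(r, s). (axis r 1, axis s 1, d r s))"
  define L where "L = {(p, q, c') | c'. c' \<le> c}"
  define T where "T = convex hull (range e)"
  have "L = {p} \<times> {q} \<times> {..c}"
    by (auto simp: L_def)
  then have "closed L" "convex L"
    by (auto intro!: closed_Times convex_Times)
  have "L \<inter> T \<noteq> {}"
  proof
    assume "L \<inter> T = {}"
    moreover have "compact T"
      unfolding T_def by (intro finite_imp_compact_convex_hull) auto
    ultimately obtain a b where ab: "\<And>x. x \<in> L \<Longrightarrow> a \<bullet> x < b" "\<And>x. x \<in> T \<Longrightarrow> b < a \<bullet> x"
      using separating_hyperplane_closed_compact[OF \<open>convex L\<close> \<open>closed L\<close>, of T]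
      by (metis T_def convex_convex_hull convex_hull_eq_empty image_is_empty UNIV_not_empty)
    obtain u v w where a: "a = (u, v, w)"
      by (metis prod.exhaust)
    have L: "u \<bullet> p + v \<bullet> q + w * c' < b" if "c' \<le> c" for c'
      using ab(1)[of "(p, q, c')"] that by (simp add: a L_def)
    have T: "b < u $ r + v $ s + w * d r s" for r s
    proof -
      have "e (r, s) \<in> T"
        by (simp add: T_def hull_inc)
      from ab(2)[OF this] show ?thesis
        by (simp add: a e_def inner_axis add.assoc)
    qed
    \<comment> \<open>The cost of the product coupling. Averaging the separation inequality over
      that coupling and comparing with a point of \<open>L\<close> at cost \<open>min c ?C\<close>
      forces the coefficient \<open>w\<close> to be positive.\<close>
    let ?C = "\<Sum>r\<in>UNIV. \<Sum>s\<in>UNIV. p $ r * q $ s * d r s"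
    have "b = (\<Sum>r\<in>UNIV. \<Sum>s\<in>UNIV. p $ r * q $ s * b)"
      using p q by (simp add: prob_vector_def sum_distrib_left[symmetric] sum_distrib_right[symmetric])
    also have "\<dots> \<le> (\<Sum>r\<in>UNIV. \<Sum>s\<in>UNIV. p $ r * q $ s * (u $ r + v $ s + w * d r s))"
      using p q T by (intro sum_mono mult_left_mono) (auto simp: prob_vector_def intro: less_imp_le)
    also have "\<dots> = u \<bullet> p + v \<bullet> q + w * ?C"
    proof -
      have "(\<Sum>r\<in>UNIV. \<Sum>s\<in>UNIV. p $ r * q $ s * u $ r) = (\<Sum>r\<in>UNIV. u $ r * p $ r * (\<Sum>s\<in>UNIV. q $ s))"
        by (simp add: sum_distrib_left mult_ac)
      moreover have "(\<Sum>r\<in>UNIV. \<Sum>s\<in>UNIV. p $ r * q $ s * v $ s) = (\<Sum>s\<in>UNIV. v $ s * q $ s * (\<Sum>r\<in>UNIV. p $ r))"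
        by (subst sum.swap) (simp add: sum_distrib_left mult_ac)
      moreover have "(\<Sum>r\<in>UNIV. \<Sum>s\<in>UNIV. p $ r * q $ s * (w * d r s)) = w * ?C"
        by (simp add: sum_distrib_left mult_ac)
      ultimately show ?thesis
        using p q by (simp add: prob_vector_def inner_vec_def distrib_left sum.distrib)
    qed
    finally have "w * min c ?C < w * ?C"
      using L[of "min c ?C"] by simp
    then have "0 < w"
      by (simp add: mult_less_cancel_left)
    \<comment> \<open>Division by \<open>w\<close> gives the distance the coefficient
      \<open>1\<close>.\<close>
    have "\<exists>f\<in>lip_functions d. c < (p - q) \<bullet> f"
    proof (rule dual_potential[OF d p q, where u = "u /\<^sub>R w" and v = "v /\<^sub>R w" and b = "b / w"])
      show "(u /\<^sub>R w) \<bullet> p + (v /\<^sub>R w) \<bullet> q + c < b / w"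
        using divide_strict_right_mono[OF L[of c] \<open>0 < w\<close>] \<open>0 < w\<close>
        by (simp add: divide_inverse_commute[symmetric] add_divide_distrib)
      show "b / w \<le> (u /\<^sub>R w) $ r + (v /\<^sub>R w) $ s + d r s" for r s
        using T[of r s] \<open>0 < w\<close> by (simp add: field_simps)
    qed
    with c show False
      using not_le by blast
  qed
  then obtain c' where c': "c' \<le> c" "(p, q, c') \<in> T"
    by (auto simp: L_def)
  \<comment> \<open>Injectivity lets the convex weights on \<open>range e\<close> be indexed by
    pairs of states; these weights are the coupling.\<close>
  have "inj e"
    by (auto simp: inj_def e_def axis_eq_axis)
  obtain y where y: "\<forall>x\<in>range e. 0 \<le> y x" "(\<Sum>x\<in>range e. y x *\<^sub>R x) = (p, q, c')"
    using c'(2) unfolding T_def convex_hull_finite[OF finite_imageI[OF finite_class.finite_UNIV]]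
    by blast
  define \<gamma> :: "real ^ 'n ^ 'n" where "\<gamma> = (\<chi> r s. y (e (r, s)))"
  have "(p, q, c') = (\<Sum>z\<in>UNIV. y (e z) *\<^sub>R e z)"
    using y(2) by (simp add: sum.reindex[OF \<open>inj e\<close>])
  also have "\<dots> = (\<Sum>r\<in>UNIV. \<Sum>s\<in>UNIV. \<gamma> $ r $ s *\<^sub>R (axis r 1, axis s 1, d r s))"
    by (simp add: sum.cartesian_product \<gamma>_def e_def case_prod_unfold)
  finally have eqs: "p = (\<Sum>r\<in>UNIV. \<Sum>s\<in>UNIV. \<gamma> $ r $ s *\<^sub>R axis r 1)"
      "q = (\<Sum>r\<in>UNIV. \<Sum>s\<in>UNIV. \<gamma> $ r $ s *\<^sub>R axis s 1)"
      "c' = (\<Sum>r\<in>UNIV. \<Sum>s\<in>UNIV. \<gamma> $ r $ s * d r s)"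
    by (simp_all add: prod_eq_iff fst_sum snd_sum)
  have "\<gamma> \<in> couplings p q"
    unfolding couplings_def
  proof (intro CollectI conjI allI)
    show "0 \<le> \<gamma> $ r $ s" for r s
      using y(1) by (simp add: \<gamma>_def)
    show "(\<Sum>s\<in>UNIV. \<gamma> $ r $ s) = p $ r" for r
      by (subst eqs(1)) (simp add: axis_def if_distrib scaleR_sum_left[symmetric] cong: if_cong)
    show "(\<Sum>r\<in>UNIV. \<gamma> $ r $ s) = q $ s" for s
      by (subst eqs(2)) (simp add: axis_def if_distrib cong: if_cong)
  qed
  with c'(1) show ?thesis
    unfolding eqs(3) by (auto simp: mult.commute)
qed

lemma coupling_cost_ge:
  assumes "\<gamma> \<in> couplings p q" and "f \<in> lip_functions d"
  shows "(p - q) \<bullet> f \<le> (\<Sum>r\<in>UNIV. \<Sum>s\<in>UNIV. d r s * \<gamma> $ r $ s)"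
  unfolding coupling_diff_inner[OF assms(1)]
proof (intro sum_mono)
  fix r s
  have "f $ r - f $ s \<le> d r s"
    using assms(2) by (auto simp: lip_functions_def abs_le_iff)
  then show "\<gamma> $ r $ s * (f $ r - f $ s) \<le> d r s * \<gamma> $ r $ s"
    using assms(1) by (simp add: couplings_def mult.commute[of "d r s"] mult_left_mono)
qed

lemma W1_duality:
  fixes d :: "'n::finite \<Rightarrow> 'n \<Rightarrow> real"
  assumes d: "Metric_space UNIV d" and p: "prob_vector p" and q: "prob_vector q"
  shows "W1 d p q = support_function (lip_functions d) (p - q)"
    and "\<exists>\<gamma>\<in>couplings p q. (\<Sum>r\<in>UNIV. \<Sum>s\<in>UNIV. d r s * \<gamma> $ r $ s) = W1 d p q"
proof -
  let ?cost = "\<lambda>\<gamma>. \<Sum>r\<in>UNIV. \<Sum>s\<in>UNIV. d r s * \<gamma> $ r $ s"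
  let ?V = "support_function (lip_functions d) (p - q)"
  note F = compact_lip_functions lip_functions_nonempty[OF d]
  \<comment> \<open>Taking the dual value itself as the cost bound produces an optimal
    coupling.\<close>
  obtain \<gamma> where \<gamma>: "\<gamma> \<in> couplings p q" "?cost \<gamma> \<le> ?V"
    by (rule bexE[OF exists_coupling_cost_le[OF d p q support_function_upper[OF F(1)]]])
  have V_le: "?V \<le> ?cost \<gamma>'" if "\<gamma>' \<in> couplings p q" for \<gamma>'
  proof -
    obtain f where "f \<in> lip_functions d" "?V = (p - q) \<bullet> f"
      using support_function_attained[OF F] .
    then show ?thesis
      using coupling_cost_ge[OF that] by simp
  qed
  show *: "W1 d p q = ?V"
    unfolding W1_def
  proof (rule cInf_eq_minimum)
    show "?V \<in> ?cost ` couplings p q"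
      using \<gamma> V_le[OF \<gamma>(1)] by (intro image_eqI[of _ _ \<gamma>]) simp_all
  qed (use V_le in auto)
  show "\<exists>\<gamma>\<in>couplings p q. ?cost \<gamma> = W1 d p q"
    unfolding * using \<gamma> V_le by (intro bexI[of _ \<gamma>] antisym) simp_all
qed

subsection \<open>Curvature bounds\<close>

text \<open>Since rows sum to zero, \<open>Q $ r \<bullet> h\<close> depends only on the increments
  of \<open>h\<close> from \<open>r\<close>. Off the diagonal they carry nonnegative weights, and at
  \<open>r\<close> the increment is zero.\<close>

lemma generator_inner_mono:
  assumes "generator_matrix Q" and "\<And>j. f $ j - f $ r \<le> g $ j - g $ r"
  shows "Q $ r \<bullet> f \<le> Q $ r \<bullet> g"
proof -
  have "Q $ r \<bullet> h = (\<Sum>j\<in>UNIV. Q $ r $ j * (h $ j - h $ r))" for h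
    using assms(1)
    by (simp add: inner_vec_def generator_matrix_def right_diff_distrib sum_subtractf
        sum_distrib_right[symmetric])
  moreover have "(\<Sum>j\<in>UNIV. Q $ r $ j * (f $ j - f $ r)) \<le> (\<Sum>j\<in>UNIV. Q $ r $ j * (g $ j - g $ r))"
  proof (rule sum_mono)
    show "Q $ r $ j * (f $ j - f $ r) \<le> Q $ r $ j * (g $ j - g $ r)" for j
      using assms by (cases "j = r") (auto simp: generator_matrix_def intro!: mult_left_mono)
  qed
  ultimately show ?thesis by simp
qed

text \<open>Increments of \<open>f\<close> from \<open>r\<close> are at most those of the distance
  from \<open>r\<close> by the Lipschitz property, and at most those of the distance from
  \<open>s\<close> because \<open>f\<close> drops by the full \<open>d r s\<close> between
  \<open>r\<close> and \<open>s\<close>. The same holds for \<open>- f\<close> at \<open>s\<close>.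
  Two bounds at each point explain the two minima in \<open>kcurv\<close>.\<close>

lemma generator_diff_le_kcurv:
  assumes d: "Metric_space UNIV d" and Q: "generator_matrix Q" and "r \<noteq> s"
    and f: "f \<in> lip_functions d" and tight: "f $ r - f $ s = d r s"
  shows "(Q $ r - Q $ s) \<bullet> f \<le> - (d r s * kcurv d Q r s)"
proof -
  interpret Metric_space UNIV d by (rule d)
  have lip: "f $ i - f $ j \<le> d i j" for i j
    using f by (auto simp: lip_functions_def abs_le_iff)
  then have lip': "f $ i - f $ j \<le> d j i" for i j
    by (simp add: commute[of j i])
  have "Q $ r \<bullet> f \<le> Q $ r \<bullet> dist_vec d r"
    using lip'[of _ r] by (intro generator_inner_mono Q) (simp add: dist_vec_def)
  moreover have "Q $ r \<bullet> f \<le> Q $ r \<bullet> dist_vec d s"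
    using lip'[of _ s] tight
    by (intro generator_inner_mono Q) (simp add: dist_vec_def commute[of s r] algebra_simps)
  moreover have "Q $ s \<bullet> (- f) \<le> Q $ s \<bullet> dist_vec d s"
    using lip[of s] by (intro generator_inner_mono Q) (simp add: dist_vec_def)
  moreover have "Q $ s \<bullet> (- f) \<le> Q $ s \<bullet> dist_vec d r"
    using lip[of r] tight
    by (intro generator_inner_mono Q) (simp add: dist_vec_def algebra_simps)
  moreover have "d r s * kcurv d Q r s =
      - (min (Q $ r \<bullet> dist_vec d r) (Q $ r \<bullet> dist_vec d s) +
        min (Q $ s \<bullet> dist_vec d s) (Q $ s \<bullet> dist_vec d r))"
    using \<open>r \<noteq> s\<close> by (simp add: kcurv_def)
  ultimately show ?thesis
    by (simp add: inner_diff_left)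
qed

section \<open>Right derivatives of the Wasserstein distance\<close>

lemma right_deriv_eq:
  assumes "(f has_real_derivative D) (at_right t)"
  shows "right_deriv f t = D"
  unfolding right_deriv_def
proof (rule the_equality[where P = "\<lambda>D. (f has_real_derivative D) (at_right t)"])
  show "D' = D" if "(f has_real_derivative D') (at_right t)" for D'
    using that assms tendsto_unique[OF trivial_limit_at_right_real]
    unfolding has_field_derivative_iff by blast
qed (rule assms)

text \<open>Duality turns \<open>W1\<close> into a support function wherever both curves consist of
  probability vectors. This is assumed from \<open>t\<close> onwards only, which is all that a right
  derivative sees.\<close>

lemma has_right_derivative_W1:
  fixes d :: "'n::finite \<Rightarrow> 'n \<Rightarrow> real"
  assumes d: "Metric_space UNIV d"
    and prob: "\<And>s. t \<le> s \<Longrightarrow> prob_vector (p s)" "\<And>s. t \<le> s \<Longrightarrow> prob_vector (q s)"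
    and deriv: "\<And>j. ((\<lambda>s. p s $ j) has_real_derivative p' $ j) (at_right t)"
      "\<And>j. ((\<lambda>s. q s $ j) has_real_derivative q' $ j) (at_right t)"
  obtains f where "f \<in> lip_functions d" and "(p t - q t) \<bullet> f = W1 d (p t) (q t)"
    and "\<forall>g\<in>lip_functions d. (p t - q t) \<bullet> g = W1 d (p t) (q t) \<longrightarrow>
        (p' - q') \<bullet> g \<le> (p' - q') \<bullet> f"
    and "((\<lambda>s. W1 d (p s) (q s)) has_real_derivative (p' - q') \<bullet> f) (at_right t)"
proof -
  let ?F = "lip_functions d"
  have W: "W1 d (p s) (q s) = support_function ?F (p s - q s)" if "t \<le> s" for s
    using that by (intro W1_duality d prob)
  have "((\<lambda>s. (p s - q s) $ j) has_real_derivative (p' - q') $ j) (at_right t)" for j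
    unfolding vector_minus_component by (intro DERIV_diff deriv)
  from has_right_derivative_support_function[OF compact_lip_functions lip_functions_nonempty[OF d] this]
  obtain f where f: "f \<in> ?F" "(p t - q t) \<bullet> f = support_function ?F (p t - q t)"
    "\<forall>g\<in>?F. (p t - q t) \<bullet> g = support_function ?F (p t - q t) \<longrightarrow>
        (p' - q') \<bullet> g \<le> (p' - q') \<bullet> f"
    "((\<lambda>s. support_function ?F (p s - q s)) has_real_derivative (p' - q') \<bullet> f) (at_right t)"
    .
  have "((\<lambda>s. W1 d (p s) (q s)) has_real_derivative (p' - q') \<bullet> f) (at_right t)"
    unfolding has_field_derivative_iff W[OF order_refl]
    by (rule Lim_transform_eventually[OF f(4)[unfolded has_field_derivative_iff]])
      (use eventually_at_right_less[of t] in \<open>eventually_elim; simp add: W\<close>)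
  with f show thesis
    by (intro that[of f]) (simp_all add: W)
qed

lemma inner_axis_diff: "(axis r 1 - axis s 1) \<bullet> f = f $ r - f $ s" for f :: "real ^ 'n"
  by (simp add: inner_diff_left inner_axis')

lemma axis_vector_matrix: "axis r 1 v* M = M $ r" for M :: "real ^ 'n ^ 'm"
  by (simp add: vec_eq_iff vector_matrix_mult_def axis_def if_distrib if_distribR cong: if_cong)

lemma prob_vector_axis: "prob_vector (axis r 1)"
  by (auto simp: prob_vector_def axis_def)

text \<open>The derivative in \<open>kappa\<close> is the largest value of
  \<open>(Q $ r - Q $ s) \<bullet> g\<close> over potentials \<open>g\<close> optimal between the
  two Dirac vectors, and tightness makes \<open>f\<close> one of these potentials.\<close>

lemma generator_diff_le_kappa:
  fixes d :: "'n::finite \<Rightarrow> 'n \<Rightarrow> real"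
  assumes d: "Metric_space UNIV d" and Q: "generator_matrix Q" and "r \<noteq> s"
    and f: "f \<in> lip_functions d" and tight: "f $ r - f $ s = d r s"
  shows "(Q $ r - Q $ s) \<bullet> f \<le> - (d r s * kappa d Q r s)"
proof -
  let ?E = "\<lambda>t. mat_exp (t *\<^sub>R Q)"
  let ?W = "\<lambda>t. W1 d (axis r 1 v* ?E t) (axis s 1 v* ?E t)"
  have E0: "x v* ?E 0 = x" for x
    by (simp add: mat_exp_0[simplified])
  have deriv: "((\<lambda>t. (axis r 1 v* ?E t) $ j) has_real_derivative (Q $ r) $ j) (at_right 0)" for r j
    using has_real_derivative_mat_exp_row[of "axis r 1" Q j 0]
    by (simp add: E0[simplified] axis_vector_matrix has_field_derivative_at_within)
  obtain g where g: "g \<in> lip_functions d" "(axis r 1 v* ?E 0 - axis s 1 v* ?E 0) \<bullet> g = ?W 0"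
      "\<forall>h\<in>lip_functions d. (axis r 1 v* ?E 0 - axis s 1 v* ?E 0) \<bullet> h = ?W 0 \<longrightarrow>
        (Q $ r - Q $ s) \<bullet> h \<le> (Q $ r - Q $ s) \<bullet> g"
      "(?W has_real_derivative (Q $ r - Q $ s) \<bullet> g) (at_right 0)"
    using has_right_derivative_W1[where t = 0, OF d prob_vector_mat_exp[OF prob_vector_axis Q]
        prob_vector_mat_exp[OF prob_vector_axis Q] deriv deriv] .
  have "?W 0 = (axis r 1 - axis s 1) \<bullet> f"
  proof (rule antisym)
    show "?W 0 \<le> (axis r 1 - axis s 1) \<bullet> f"
      using g(1,2) tight unfolding E0 inner_axis_diff lip_functions_def mem_Collect_eq
      by (metis abs_le_D1)
    have "?W 0 = support_function (lip_functions d) (axis r 1 - axis s 1)"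
      unfolding E0 by (intro W1_duality d prob_vector_axis)
    then show "(axis r 1 - axis s 1) \<bullet> f \<le> ?W 0"
      using support_function_upper[OF compact_lip_functions f] by simp
  qed
  moreover have "d r s * kappa d Q r s = - ((Q $ r - Q $ s) \<bullet> g)"
    using right_deriv_eq[OF g(4)] \<open>r \<noteq> s\<close> Metric_space.zero[OF d, of r s]
    by (simp add: kappa_def)
  ultimately show ?thesis
    using g(3) f unfolding E0 by simp
qed

text \<open>Complementary slackness: an optimal coupling only charges pairs on which the optimal
  potential has the maximal slope.\<close>

lemma optimal_pair_generator_le:
  assumes \<gamma>: "\<gamma> \<in> couplings p q" and f: "f \<in> lip_functions d"
    and opt: "(p - q) \<bullet> f = (\<Sum>r\<in>UNIV. \<Sum>s\<in>UNIV. d r s * \<gamma> $ r $ s)"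
    and B: "\<And>r s. f $ r - f $ s = d r s \<Longrightarrow> (Q $ r - Q $ s) \<bullet> f \<le> B r s"
  shows "(p - q) \<bullet> (Q *v f) \<le> (\<Sum>r\<in>UNIV. \<Sum>s\<in>UNIV. \<gamma> $ r $ s * B r s)"
proof -
  have \<gamma>0: "0 \<le> \<gamma> $ r $ s" for r s
    using \<gamma> by (simp add: couplings_def)
  have nonneg: "0 \<le> \<gamma> $ r $ s * (d r s - (f $ r - f $ s))" for r s
    using f \<gamma>0[of r s] by (intro mult_nonneg_nonneg) (auto simp: lip_functions_def abs_le_iff)
  \<comment> \<open>The total slack is the cost of the coupling minus the value of the
    potential.\<close>
  have "(\<Sum>r\<in>UNIV. \<Sum>s\<in>UNIV. \<gamma> $ r $ s * (d r s - (f $ r - f $ s))) = 0"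
    using opt coupling_diff_inner[OF \<gamma>, of f]
    by (simp add: right_diff_distrib sum_subtractf mult.commute)
  then have slack: "\<gamma> $ r $ s * (d r s - (f $ r - f $ s)) = 0" for r s
    using nonneg by (simp add: sum_nonneg_eq_0_iff sum_nonneg)
  show ?thesis
    unfolding coupling_diff_inner[OF \<gamma>]
  proof (intro sum_mono)
    show "\<gamma> $ r $ s * ((Q *v f) $ r - (Q *v f) $ s) \<le> \<gamma> $ r $ s * B r s" for r s
    proof (cases "\<gamma> $ r $ s = 0")
      case False
      then have "f $ r - f $ s = d r s"
        using slack[of r s] by simp
      then show ?thesis
        using B \<gamma>0 by (intro mult_left_mono) (auto simp: matrix_vector_mul_component inner_diff_left)
    qed simp
  qed
qed

section \<open>Bounds by minima and row norms, and the final estimate\<close>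

lemma finite_off_diagonal: "finite {h r s | r s :: 'n::finite. r \<noteq> s}"
  using finite_imageI[of "UNIV :: ('n \<times> 'n) set" "\<lambda>(r, s). h r s"]
  by (rule rev_finite_subset) auto

lemma Min_off_diagonal_le: "r \<noteq> s \<Longrightarrow> Min {h r s | r s :: 'n::finite. r \<noteq> s} \<le> h r s"
  by (intro Min_le finite_off_diagonal) auto

lemma wnorm_upper: "f \<in> lip_functions d \<Longrightarrow> D $ i \<bullet> f \<le> wnorm d D $ i"
  using support_function_upper[OF compact_lip_functions] by (simp add: wnorm_def support_function_def)

text \<open>One \<open>f\<close> serves all rows on the left, whereas \<open>wnorm\<close> maximises
  row by row; nonnegative weights preserve the row bounds.\<close>

lemma inner_wnorm_upper:
  assumes "prob_vector x" and "f \<in> lip_functions d"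
  shows "(x v* D) \<bullet> f \<le> x \<bullet> wnorm d D"
proof -
  have "(x v* D) \<bullet> f = (\<Sum>i\<in>UNIV. x $ i * (D $ i \<bullet> f))"
    by (simp add: dot_lmul_matrix inner_vec_def[of x] matrix_vector_mul_component)
  also have "\<dots> \<le> (\<Sum>i\<in>UNIV. x $ i * wnorm d D $ i)"
    using assms by (intro sum_mono mult_left_mono wnorm_upper) (auto simp: prob_vector_def)
  finally show ?thesis
    by (simp add: inner_vec_def)
qed

theorem theorem17:
  fixes d :: "'n::finite \<Rightarrow> 'n \<Rightarrow> real"
    and p0 :: "real ^ 'n" and Q :: "real ^ 'n ^ 'n"
    and \<pi>0 :: "real ^ 'm::finite" and \<Theta> :: "real ^ 'm ^ 'm"
    and A :: "real ^ 'n ^ 'm"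
    and p p_tilde :: "real \<Rightarrow> real ^ 'n" and \<pi> :: "real \<Rightarrow> real ^ 'm"
  assumes "CARD('n) \<ge> 2"
    and "Metric_space UNIV d"
    and "prob_vector p0" and "generator_matrix Q"
    and "prob_vector \<pi>0" and "generator_matrix \<Theta>"
    and "stochastic_matrix A"
    and p_def: "\<And>t. p t = p0 v* mat_exp (t *\<^sub>R Q)"
    and \<pi>_def: "\<And>t. \<pi> t = \<pi>0 v* mat_exp (t *\<^sub>R \<Theta>)"
    and p_tilde_def: "\<And>t. p_tilde t = \<pi>0 v* mat_exp (t *\<^sub>R \<Theta>) v* A"
  shows "continuous_on {0..} (\<lambda>t. W1 d (p_tilde t) (p t)) \<and>
    (\<forall>t\<ge>0. \<exists>D. ((\<lambda>t. W1 d (p_tilde t) (p t)) has_real_derivative D) (at_right t) \<and>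
       D \<le> \<pi> t \<bullet> wnorm d (\<Theta> ** A - A ** Q) + Kconst d Q \<and>
       D \<le> \<pi> t \<bullet> wnorm d (\<Theta> ** A - A ** Q) + W1 d (p_tilde t) (p t) * (- kcurv_min d Q) \<and>
       D \<le> \<pi> t \<bullet> wnorm d (\<Theta> ** A - A ** Q) + W1 d (p_tilde t) (p t) * (- kappa_min d Q))"
proof -
  note d = assms(2) and Q = assms(4)
  interpret Metric_space UNIV d by (rule d)
  let ?W = "\<lambda>t. W1 d (p_tilde t) (p t)"
  have p_tilde: "p_tilde t = \<pi> t v* A" for t
    by (simp add: p_tilde_def \<pi>_def)
  have prob: "prob_vector (p t)" "prob_vector (\<pi> t)" "prob_vector (p_tilde t)" if "0 \<le> t" for t
    unfolding p_tilde unfolding p_def \<pi>_def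
    by (intro prob_vector_stochastic_matrix prob_vector_mat_exp assms that)+
  have p': "((\<lambda>t. p t $ j) has_real_derivative (p t v* Q) $ j) (at t)" for t j
    unfolding p_def by (rule has_real_derivative_mat_exp_row)
  have "((\<lambda>t. \<pi> t $ i) has_real_derivative (\<pi> t v* \<Theta>) $ i) (at t)" for t i
    unfolding \<pi>_def by (rule has_real_derivative_mat_exp_row)
  then have p_tilde': "((\<lambda>t. p_tilde t $ j) has_real_derivative (\<pi> t v* \<Theta> v* A) $ j) (at t)" for t j
    unfolding p_tilde unfolding vector_matrix_mult_def[of _ A] vec_lambda_beta
    by (intro DERIV_sum DERIV_cmult_right)
  have "isCont (\<lambda>t. p_tilde t - p t) t" for t
    using DERIV_isCont[OF p'] DERIV_isCont[OF p_tilde'] unfolding isCont_def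
    by (intro tendsto_diff vec_tendstoI)
  then have "continuous_on {0..} (\<lambda>t. p_tilde t - p t)"
    by (simp add: continuous_at_imp_continuous_on)
  from continuous_on_compose2[OF
      continuous_support_function[OF compact_lip_functions lip_functions_nonempty[OF d]] this]
  have "continuous_on {0..} ?W"
    \<comment> \<open>The support function is continuous everywhere; it agrees with
      \<open>W1\<close> for nonnegative times, where the vectors are probability vectors.\<close>
    by (rule continuous_on_eq) (simp_all add: W1_duality(1)[OF d] prob)
  moreover have "\<exists>D. (?W has_real_derivative D) (at_right t) \<and>
       D \<le> \<pi> t \<bullet> wnorm d (\<Theta> ** A - A ** Q) + Kconst d Q \<and>
       D \<le> \<pi> t \<bullet> wnorm d (\<Theta> ** A - A ** Q) + ?W t * (- kcurv_min d Q) \<and>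
       D \<le> \<pi> t \<bullet> wnorm d (\<Theta> ** A - A ** Q) + ?W t * (- kappa_min d Q)" if t: "0 \<le> t" for t
  proof -
    obtain f where f: "f \<in> lip_functions d" "(p_tilde t - p t) \<bullet> f = ?W t"
      "\<forall>g\<in>lip_functions d. (p_tilde t - p t) \<bullet> g = ?W t \<longrightarrow>
        (\<pi> t v* \<Theta> v* A - p t v* Q) \<bullet> g \<le> (\<pi> t v* \<Theta> v* A - p t v* Q) \<bullet> f"
      "(?W has_real_derivative (\<pi> t v* \<Theta> v* A - p t v* Q) \<bullet> f) (at_right t)"
      using has_right_derivative_W1[where t = t and p = p_tilde and q = p, OF d
            prob(3)[OF order_trans[OF t]] prob(1)[OF order_trans[OF t]]
            has_field_derivative_at_within[OF p_tilde'] has_field_derivative_at_within[OF p']] .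
    obtain \<gamma> where \<gamma>: "\<gamma> \<in> couplings (p_tilde t) (p t)"
      "(\<Sum>r\<in>UNIV. \<Sum>s\<in>UNIV. d r s * \<gamma> $ r $ s) = ?W t"
      using W1_duality(2)[OF d prob(3,1)[OF t]] by blast
    \<comment> \<open>The term \<open>p_tilde t v* Q\<close>, equal to
      \<open>\<pi> t v* A v* Q\<close>, is subtracted and added, separating the defect of
      \<open>A\<close> from the drift under \<open>Q\<close>.\<close>
    have "(\<pi> t v* \<Theta> v* A - p t v* Q) \<bullet> f =
        (\<pi> t v* (\<Theta> ** A - A ** Q)) \<bullet> f + (p_tilde t - p t) \<bullet> (Q *v f)"
      by (simp add: p_tilde vector_matrix_mult_diff_rdistrib vector_matrix_mult_diff_distrib
          vector_matrix_mul_assoc inner_diff_left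
          dot_lmul_matrix[symmetric])
    also have "\<dots> \<le> \<pi> t \<bullet> wnorm d (\<Theta> ** A - A ** Q) + (p_tilde t - p t) \<bullet> (Q *v f)"
      using inner_wnorm_upper[OF prob(2)[OF t] f(1)] by simp
    finally have D: "(\<pi> t v* \<Theta> v* A - p t v* Q) \<bullet> f \<le>
        \<pi> t \<bullet> wnorm d (\<Theta> ** A - A ** Q) + (p_tilde t - p t) \<bullet> (Q *v f)" .
    \<comment> \<open>The curvature minima cover distinct states only. Pairs \<open>r = s\<close>
      give zero on the left, so nonnegativity of \<open>B\<close> is enough there.\<close>
    have drift: "(p_tilde t - p t) \<bullet> (Q *v f) \<le> (\<Sum>r\<in>UNIV. \<Sum>s\<in>UNIV. \<gamma> $ r $ s * B r s)"
      if "\<And>r s. r \<noteq> s \<Longrightarrow> f $ r - f $ s = d r s \<Longrightarrow> (Q $ r - Q $ s) \<bullet> f \<le> B r s"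
        and "\<And>r. 0 \<le> B r r" for B
      using f(1,2) \<gamma> that by (intro optimal_pair_generator_le[where d = d]) (metis diff_self inner_zero_left)+
    \<comment> \<open>Keeping \<open>k\<close> general treats \<open>kcurv\<close> and
      \<open>kappa\<close> at once. The weights \<open>d r s\<close> integrate against the optimal
      coupling to the Wasserstein distance.\<close>
    have curv: "(p_tilde t - p t) \<bullet> (Q *v f) \<le> ?W t * (- Min {k r s | r s. r \<noteq> s})"
      if k: "\<And>r s. r \<noteq> s \<Longrightarrow> f $ r - f $ s = d r s \<Longrightarrow> (Q $ r - Q $ s) \<bullet> f \<le> - (d r s * k r s)" for k
    proof -
      let ?m = "Min {k r s | r s. r \<noteq> s}"
      have "(p_tilde t - p t) \<bullet> (Q *v f) \<le> (\<Sum>r\<in>UNIV. \<Sum>s\<in>UNIV. \<gamma> $ r $ s * - (d r s * ?m))"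
      proof (rule drift)
        fix r s assume rs: "r \<noteq> s" "f $ r - f $ s = d r s"
        have "d r s * ?m \<le> d r s * k r s"
          using Min_off_diagonal_le[OF rs(1), of k] by (intro mult_left_mono) auto
        then show "(Q $ r - Q $ s) \<bullet> f \<le> - (d r s * ?m)"
          using k[OF rs] by simp
      qed simp
      also have "\<dots> = ?W t * (- ?m)"
        unfolding \<gamma>(2)[symmetric] sum_distrib_right by (intro sum.cong refl) (simp add: mult_ac)
      finally show ?thesis .
    qed
    \<comment> \<open>A constant bound integrates to itself, as the coupling has mass one; the
      maximum with \<open>0\<close> in \<open>Kconst\<close> handles the diagonal.\<close>
    have "(p_tilde t - p t) \<bullet> (Q *v f) \<le> (\<Sum>r\<in>UNIV. \<Sum>s\<in>UNIV. \<gamma> $ r $ s * Kconst d Q)"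
    proof (rule drift)
      fix r s assume rs: "r \<noteq> s" "f $ r - f $ s = d r s"
      show "(Q $ r - Q $ s) \<bullet> f \<le> Kconst d Q"
        using generator_diff_le_kcurv[OF d Q rs(1) f(1) rs(2)]
          Min_off_diagonal_le[OF rs(1), of "\<lambda>r s. d r s * kcurv d Q r s"]
        by (simp add: Kconst_def)
    qed (simp add: Kconst_def)
    also have "\<dots> = Kconst d Q"
      using \<gamma>(1) prob(3)[OF t]
      by (simp add: couplings_def prob_vector_def sum_distrib_right[symmetric])
    finally have "(p_tilde t - p t) \<bullet> (Q *v f) \<le> Kconst d Q" .
    moreover have "(p_tilde t - p t) \<bullet> (Q *v f) \<le> ?W t * (- kcurv_min d Q)"
      unfolding kcurv_min_def using generator_diff_le_kcurv[OF d Q] f(1) by (intro curv) blast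
    moreover have "(p_tilde t - p t) \<bullet> (Q *v f) \<le> ?W t * (- kappa_min d Q)"
      unfolding kappa_min_def using generator_diff_le_kappa[OF d Q] f(1) by (intro curv) blast
    ultimately show ?thesis
      using D f(4) by (intro exI[of _ "(\<pi> t v* \<Theta> v* A - p t v* Q) \<bullet> f"] conjI) simp_all
  qed
  ultimately show ?thesis by blast
qed

end
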